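(* Let $(\mathfrak g,\langle\cdot,\cdot\rangle)$ be a $5$-dimensional metric Lie algebra. Then any strict CKY $2$-form on $(\mathfrak g,\langle\cdot,\cdot\rangle)$ whose co-differential lies in the dual of the center of $\mathfrak g$ is a $*$-KY $2$-form, i.e. it is closed.
   Context: A metric Lie algebra $(\mathfrak g,\langle\cdot,\cdot\rangle)$ is a finite-dimensional real Lie algebra with an inner product; $\nabla$ is given by $2\langle\nabla_xy,z\rangle=\langle[x,y],z\rangle-\langle[y,z],x\rangle+\langle[z,x],y\rangle$, and $(\nabla_xT)y=\nabla_x(Ty)-T(\nabla_xy)$. A $2$-form $\omega\in\Lambda^2\mathfrak g^*$ corresponds to the skew-symmetric endomorphism $T$ with $\omega(x,y)=\langle Tx,y\rangle$. $\omega$ (or $T$) is CKY (conformal Killing-Yano) if there is $\theta\in\mathfrak g^*$ with $$\langle(\nabla_xT)y,z\rangle+\langle(\nabla_yT)x,z\rangle=2\langle x,y\rangle\theta(z)-\langle y,z\rangle\theta(x)-\langle x,z\rangle\theta(y)\quad\text{for all }x,y,z\in\mathfrak g;$$ then $\theta=-\frac1{n-1}d^*\omega$ where $n=\dim\mathfrak g$ and $d^*$ is the co-differential. It is strict if $\theta\neq0$. The associated vector is the $\xi\in\mathfrak g$ with $\theta=\langle\xi,\cdot\rangle$; "the co-differential lies in the dual of the center" means that $\xi$ belongs to the center of $\mathfrak g$. A $*$-KY form is a closed CKY form, where $d\omega(x,y,z)=-\omega([x,y],z)-\omega([y,z],x)-\omega([z,x],y)$. *)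

theory Defs
  imports "HOL-Analysis.Analysis"
begin

text \<open>A metric Lie algebra is modelled on a type of class \<^class>\<open>euclidean_space\<close>, which carries the
  inner product, together with a Lie bracket \<open>br\<close>. Elements of the dual space are functions
  satisfying \<^const>\<open>linear\<close>.\<close>

definition lie_bracket :: "('a::euclidean_space \<Rightarrow> 'a \<Rightarrow> 'a) \<Rightarrow> bool" where
  "lie_bracket br \<longleftrightarrow> bilinear br \<and> (\<forall>x. br x x = 0) \<and>
     (\<forall>x y z. br x (br y z) + br y (br z x) + br z (br x y) = 0)"

definition lie_center :: "('a::euclidean_space \<Rightarrow> 'a \<Rightarrow> 'a) \<Rightarrow> 'a set" where
  "lie_center br = {z. \<forall>x. br z x = 0}"

definition two_form :: "('a::euclidean_space \<Rightarrow> 'a \<Rightarrow> real) \<Rightarrow> bool" where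
  "two_form \<omega> \<longleftrightarrow> bilinear \<omega> \<and> (\<forall>x. \<omega> x x = 0)"

text \<open>The vector metrically dual to a functional; meaningful only for linear \<open>f\<close>.\<close>

definition sharp :: "('a::euclidean_space \<Rightarrow> real) \<Rightarrow> 'a" where
  "sharp f = (THE v. \<forall>z. v \<bullet> z = f z)"

lemma sharp_unique:
  assumes "\<And>z. v \<bullet> z = f z"
  shows "sharp f = v"
  unfolding sharp_def
proof (rule the_equality)
  fix w assume "\<forall>z. w \<bullet> z = f z"
  then have "\<forall>z. w \<bullet> z = v \<bullet> z" using assms by simp
  then show "w = v" by (metis vector_eq_rdot)
qed (simp add: assms)

lemma sharp_inner:
  assumes "linear f"
  shows "sharp f \<bullet> z = f z"
proof -
  define v where "v = (\<Sum>b\<in>Basis. f b *\<^sub>R b)"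
  have v: "v \<bullet> z = f z" for z
  proof -
    have "f z = f (\<Sum>b\<in>Basis. (z \<bullet> b) *\<^sub>R b)" by (simp add: euclidean_representation)
    also have "\<dots> = (\<Sum>b\<in>Basis. (z \<bullet> b) * f b)"
      using assms by (simp add: linear_sum linear_cmul)
    also have "\<dots> = v \<bullet> z"
      by (simp add: v_def inner_sum_left inner_commute[of z] mult.commute)
    finally show ?thesis by simp
  qed
  then show ?thesis using sharp_unique[of v f] by simp
qed

text \<open>The Levi-Civita connection, given by the Koszul formula (see \<open>nabla_koszul\<close>).\<close>

definition nabla :: "('a::euclidean_space \<Rightarrow> 'a \<Rightarrow> 'a) \<Rightarrow> 'a \<Rightarrow> 'a \<Rightarrow> 'a" where
  "nabla br x y = sharp (\<lambda>z. (br x y \<bullet> z - br y z \<bullet> x + br z x \<bullet> y) / 2)"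

lemma nabla_koszul:
  assumes "lie_bracket br"
  shows "2 * (nabla br x y \<bullet> z) = br x y \<bullet> z - br y z \<bullet> x + br z x \<bullet> y"
proof -
  have b: "bilinear br" using assms by (simp add: lie_bracket_def)
  have "linear (\<lambda>z. (br x y \<bullet> z - br y z \<bullet> x + br z x \<bullet> y) / 2)"
    by (rule linearI)
      (simp_all add: bilinear_ladd[OF b] bilinear_radd[OF b] bilinear_lmul[OF b]
        bilinear_rmul[OF b] inner_add_left inner_add_right field_simps)
  from sharp_inner[OF this, of z] show ?thesis by (simp add: nabla_def field_simps)
qed

text \<open>The endomorphism \<open>T\<close> with \<open>\<omega> x y = T x \<bullet> y\<close>.\<close>

definition endo_of :: "('a::euclidean_space \<Rightarrow> 'a \<Rightarrow> real) \<Rightarrow> 'a \<Rightarrow> 'a" where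
  "endo_of \<omega> x = sharp (\<omega> x)"

lemma endo_of_inner:
  assumes "two_form \<omega>"
  shows "endo_of \<omega> x \<bullet> y = \<omega> x y"
  using assms sharp_inner[of "\<omega> x"] by (simp add: endo_of_def two_form_def bilinear_def)

definition nabla_endo ::
    "('a::euclidean_space \<Rightarrow> 'a \<Rightarrow> 'a) \<Rightarrow> 'a \<Rightarrow> ('a \<Rightarrow> 'a) \<Rightarrow> 'a \<Rightarrow> 'a" where
  "nabla_endo br x T y = nabla br x (T y) - T (nabla br x y)"

definition CKY_eq ::
    "('a::euclidean_space \<Rightarrow> 'a \<Rightarrow> 'a) \<Rightarrow> ('a \<Rightarrow> 'a \<Rightarrow> real) \<Rightarrow> ('a \<Rightarrow> real) \<Rightarrow> bool" where
  "CKY_eq br \<omega> \<theta> \<longleftrightarrow>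
     (\<forall>x y z. nabla_endo br x (endo_of \<omega>) y \<bullet> z + nabla_endo br y (endo_of \<omega>) x \<bullet> z
        = 2 * (x \<bullet> y) * \<theta> z - (y \<bullet> z) * \<theta> x - (x \<bullet> z) * \<theta> y)"

definition CKY :: "('a::euclidean_space \<Rightarrow> 'a \<Rightarrow> 'a) \<Rightarrow> ('a \<Rightarrow> 'a \<Rightarrow> real) \<Rightarrow> bool" where
  "CKY br \<omega> \<longleftrightarrow> two_form \<omega> \<and> (\<exists>\<theta>. linear \<theta> \<and> CKY_eq br \<omega> \<theta>)"

definition strict_CKY :: "('a::euclidean_space \<Rightarrow> 'a \<Rightarrow> 'a) \<Rightarrow> ('a \<Rightarrow> 'a \<Rightarrow> real) \<Rightarrow> bool" where
  "strict_CKY br \<omega> \<longleftrightarrow>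
     two_form \<omega> \<and> (\<exists>\<theta>. linear \<theta> \<and> \<theta> \<noteq> (\<lambda>_. 0) \<and> CKY_eq br \<omega> \<theta>)"

text \<open>The co-differential \<open>d\<^sup>*\<omega> = - (\<Sum>i. (\<nabla>\<^bsub>e i\<^esub> \<omega>) (e i))\<close> over an orthonormal basis, where
  \<open>(\<nabla>\<^bsub>u\<^esub> \<omega>) x y = (\<nabla>\<^bsub>u\<^esub> T) x \<bullet> y\<close>.\<close>

definition codifferential ::
    "('a::euclidean_space \<Rightarrow> 'a \<Rightarrow> 'a) \<Rightarrow> ('a \<Rightarrow> 'a \<Rightarrow> real) \<Rightarrow> 'a \<Rightarrow> real" where
  "codifferential br \<omega> x = - (\<Sum>e\<in>Basis. nabla_endo br e (endo_of \<omega>) e \<bullet> x)"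

lemma CKY_eq_codifferential:
  fixes br :: "'a::euclidean_space \<Rightarrow> 'a \<Rightarrow> 'a"
  assumes "linear \<theta>" and "CKY_eq br \<omega> \<theta>" and "DIM('a) > 1"
  shows "\<theta> x = - codifferential br \<omega> x / (real DIM('a) - 1)"
proof -
  let ?N = "\<lambda>e. nabla_endo br e (endo_of \<omega>) e \<bullet> x"
  have N: "?N e = \<theta> x - (e \<bullet> x) * \<theta> e" if "e \<in> Basis" for e
  proof -
    have "?N e + ?N e = 2 * (e \<bullet> e) * \<theta> x - (e \<bullet> x) * \<theta> e - (e \<bullet> x) * \<theta> e"
      using assms(2) unfolding CKY_eq_def by blast
    with that show ?thesis by (simp add: mult.commute)
  qed
  have tr: "(\<Sum>e\<in>Basis. (e \<bullet> x) * \<theta> e) = \<theta> x"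
  proof -
    have "\<theta> x = \<theta> (\<Sum>e\<in>Basis. (x \<bullet> e) *\<^sub>R e)" by (simp add: euclidean_representation)
    also have "\<dots> = (\<Sum>e\<in>Basis. (x \<bullet> e) * \<theta> e)"
      using assms(1) by (simp add: linear_sum linear_cmul)
    finally show ?thesis by (simp only: inner_commute[of x])
  qed
  have "- codifferential br \<omega> x = (\<Sum>e\<in>Basis. \<theta> x - (e \<bullet> x) * \<theta> e)"
    by (simp add: codifferential_def N)
  also have "\<dots> = (real DIM('a) - 1) * \<theta> x"
    by (simp add: sum_subtractf tr left_diff_distrib)
  finally show ?thesis using assms(3) by (simp add: field_simps)
qed

text \<open>The vector \<open>\<xi>\<close> dual to \<open>\<theta> = - d\<^sup>*\<omega> / (n - 1)\<close>.\<close>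

definition cky_vector :: "('a::euclidean_space \<Rightarrow> 'a \<Rightarrow> 'a) \<Rightarrow> ('a \<Rightarrow> 'a \<Rightarrow> real) \<Rightarrow> 'a" where
  "cky_vector br \<omega> = sharp (\<lambda>x. - codifferential br \<omega> x / (real DIM('a) - 1))"

lemma cky_vector_inner:
  fixes br :: "'a::euclidean_space \<Rightarrow> 'a \<Rightarrow> 'a"
  assumes "linear \<theta>" and "CKY_eq br \<omega> \<theta>" and "DIM('a) > 1"
  shows "\<theta> x = cky_vector br \<omega> \<bullet> x"
proof -
  have "(\<lambda>x. - codifferential br \<omega> x / (real DIM('a) - 1)) = \<theta>"
    using CKY_eq_codifferential[OF assms] by auto
  then show ?thesis using sharp_inner[OF assms(1)] by (simp add: cky_vector_def)
qed

definition ext_deriv ::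
    "('a::euclidean_space \<Rightarrow> 'a \<Rightarrow> 'a) \<Rightarrow> ('a \<Rightarrow> 'a \<Rightarrow> real) \<Rightarrow> 'a \<Rightarrow> 'a \<Rightarrow> 'a \<Rightarrow> real" where
  "ext_deriv br \<omega> x y z = - \<omega> (br x y) z - \<omega> (br y z) x - \<omega> (br z x) y"

definition closed_form :: "('a::euclidean_space \<Rightarrow> 'a \<Rightarrow> 'a) \<Rightarrow> ('a \<Rightarrow> 'a \<Rightarrow> real) \<Rightarrow> bool" where
  "closed_form br \<omega> \<longleftrightarrow> (\<forall>x y z. ext_deriv br \<omega> x y z = 0)"

definition star_KY :: "('a::euclidean_space \<Rightarrow> 'a \<Rightarrow> 'a) \<Rightarrow> ('a \<Rightarrow> 'a \<Rightarrow> real) \<Rightarrow> bool" where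
  "star_KY br \<omega> \<longleftrightarrow> CKY br \<omega> \<and> closed_form br \<omega>"

end

theory Submission
  imports Defs
begin

text \<open>Let \<open>T\<close> be the endomorphism of \<open>\<omega>\<close> and \<open>A = d\<omega> / 3\<close>. The CKY equation says
  \<open>\<langle>(\<nabla>\<^bsub>x\<^esub> T) y, z\<rangle> = A x y z + \<langle>x, y\<rangle> \<theta> z - \<langle>x, z\<rangle> \<theta> y\<close>. As \<open>\<xi>\<close> is central,
  \<open>D x = \<nabla>\<^bsub>x\<^esub> \<xi> = \<nabla>\<^bsub>\<xi>\<^esub> x\<close> is skew. Evaluating \<open>A \<xi> y \<xi> = 0\<close> gives \<open>D (T \<xi>) = 0\<close>, and then
  \<open>A (T \<xi>) \<xi> (T \<xi>) = 0\<close> reads \<open>|T \<xi>|\<^sup>2 |\<xi>|\<^sup>2 = 0\<close>, so \<open>T \<xi> = 0\<close>. It follows that \<open>A\<close> vanishes on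
  \<open>\<xi>\<close> and that \<open>D\<close> is, up to the factor \<open>|\<xi>|\<^sup>2\<close>, inverse to \<open>T\<close> on \<open>\<xi>\<^sup>\<bottom>\<close>. By the Jacobi identity the
  \<open>2\<close>-form of \<open>D\<close> is closed; rewritten in terms of \<open>T\<close> this says that \<open>T\<close> acts trivially, as a
  derivation, on \<open>A\<close>. On the \<open>4\<close>-dimensional space \<open>\<xi>\<^sup>\<bottom>\<close> the form \<open>A\<close> is the Hodge dual of a
  vector \<open>a\<close>, hence \<open>T a = 0\<close> and so \<open>a = 0\<close>.\<close>

section \<open>Alternating 3-forms annihilated by a skew map\<close>

text \<open>Normalise \<open>c\<close> and extend it to an orthonormal basis. The expansion keeps
  \<open>c\<close> itself, not its unit multiple, so that \<xi> can be inserted without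
  rescaling.\<close>

lemma orthonormal_basis_5:
  fixes c :: "'a::euclidean_space"
  assumes "DIM('a) = 5" and "c \<noteq> 0"
  obtains e1 e2 e3 e4 :: 'a where
    "\<And>x. x = (x \<bullet> c / (c \<bullet> c)) *\<^sub>R c + (x \<bullet> e1) *\<^sub>R e1 + (x \<bullet> e2) *\<^sub>R e2 + (x \<bullet> e3) *\<^sub>R e3 + (x \<bullet> e4) *\<^sub>R e4"
    "e1 \<bullet> c = 0" "e2 \<bullet> c = 0" "e3 \<bullet> c = 0" "e4 \<bullet> c = 0"
    "e1 \<bullet> e1 = 1" "e2 \<bullet> e2 = 1" "e3 \<bullet> e3 = 1" "e4 \<bullet> e4 = 1"
    "e1 \<bullet> e2 = 0" "e1 \<bullet> e3 = 0" "e1 \<bullet> e4 = 0" "e2 \<bullet> e3 = 0" "e2 \<bullet> e4 = 0" "e3 \<bullet> e4 = 0"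
proof -
  define a where "a = c /\<^sub>R norm c"
  have "norm a = 1" using \<open>c \<noteq> 0\<close> by (simp add: a_def)
  then obtain S where S: "a \<in> S" "pairwise orthogonal S" "\<And>x. x \<in> S \<Longrightarrow> norm x = 1"
    "card S = DIM('a)" "span S = UNIV"
    using vector_in_orthonormal_basis by metis
  have fin: "finite S" using S(4) by (metis DIM_positive card.infinite less_irrefl)
  have "card (S - {a}) = 4" using S(1,4) assms(1) fin by simp
  then obtain e1 e2 e3 e4 where e: "S - {a} = {e1, e2, e3, e4}"
    and d: "e1 \<noteq> e2" "e1 \<noteq> e3" "e1 \<noteq> e4" "e2 \<noteq> e3" "e2 \<noteq> e4" "e3 \<noteq> e4"
    by (auto simp: card_Suc_eq numeral_eq_Suc)
  have Se: "S = {a, e1, e2, e3, e4}" using e S(1) by auto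
  have da: "a \<noteq> e1" "a \<noteq> e2" "a \<noteq> e3" "a \<noteq> e4" using e by auto
  have ortho: "x \<bullet> y = 0" if "x \<in> S" "y \<in> S" "x \<noteq> y" for x y
    using S(2) that by (auto simp: pairwise_def orthogonal_def)
  have unit: "x \<bullet> x = 1" if "x \<in> S" for x using S(3)[OF that] by (simp add: norm_eq_1)
  have aa: "(x \<bullet> a) *\<^sub>R a = (x \<bullet> c / (c \<bullet> c)) *\<^sub>R c" for x
    by (simp add: a_def power2_norm_eq_inner[symmetric] power2_eq_square field_simps)
  have expand: "x = (\<Sum>v\<in>S. (v \<bullet> x) *\<^sub>R v)" for x
  proof -
    have "(x - (\<Sum>v\<in>S. (v \<bullet> x) *\<^sub>R v)) \<bullet> w = 0" if "w \<in> S" for w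
    proof -
      have "(\<Sum>v\<in>S. (v \<bullet> x) *\<^sub>R v) \<bullet> w = (\<Sum>v\<in>S. if v = w then w \<bullet> x else 0)"
        unfolding inner_sum_left by (rule sum.cong) (use ortho unit that in auto)
      then show ?thesis using that fin by (simp add: inner_diff_left inner_commute[of x w])
    qed
    then have "orthogonal (x - (\<Sum>v\<in>S. (v \<bullet> x) *\<^sub>R v)) w" for w
      by (intro orthogonal_to_span[of w S]) (simp_all add: S(5) orthogonal_def)
    from this[of "x - (\<Sum>v\<in>S. (v \<bullet> x) *\<^sub>R v)"] show ?thesis by (simp add: orthogonal_self)
  qed
  have c: "c = norm c *\<^sub>R a" using \<open>c \<noteq> 0\<close> by (simp add: a_def)
  have ec: "e \<bullet> c = 0" if "e \<in> S" "a \<noteq> e" for e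
    using ortho[of e a] S(1) that by (subst c) auto
  show ?thesis
  proof
    show "x = (x \<bullet> c / (c \<bullet> c)) *\<^sub>R c + (x \<bullet> e1) *\<^sub>R e1 + (x \<bullet> e2) *\<^sub>R e2 + (x \<bullet> e3) *\<^sub>R e3
        + (x \<bullet> e4) *\<^sub>R e4" for x
      by (rule trans[OF expand])
        (use d da in \<open>simp add: Se aa[symmetric] inner_commute[of _ x] add.assoc\<close>)
  qed (use d da in \<open>simp_all add: Se ortho unit ec\<close>)
qed

text \<open>Since \<open>c\<close> annihilates \<open>A\<close>, everything happens on the
  4-dimensional complement of \<open>c\<close>. There \<open>A\<close> is the volume form contracted
  with a vector \<open>a\<close>; the derivation hypothesis becomes \<open>T a = 0\<close>, and
  \<open>inj\<close> gives \<open>a = 0\<close>.\<close>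

lemma alternating_3_form_eq_0:
  fixes A :: "'a::euclidean_space \<Rightarrow> 'a \<Rightarrow> 'a \<Rightarrow> real"
  assumes dim: "DIM('a) = 5"
    and lin: "\<And>y z. linear (\<lambda>x. A x y z)"
    and alt12: "\<And>x y z. A x y z = - A y x z" and alt23: "\<And>x y z. A x y z = - A x z y"
    and T: "linear T" "\<And>x y. T x \<bullet> y = - (x \<bullet> T y)"
    and c: "c \<noteq> 0" "T c = 0" "\<And>y z. A c y z = 0"
    and inj: "\<And>x. x \<bullet> c = 0 \<Longrightarrow> T x = 0 \<Longrightarrow> x = 0"
    and deriv: "\<And>x y z. x \<bullet> c = 0 \<Longrightarrow> y \<bullet> c = 0 \<Longrightarrow> z \<bullet> c = 0 \<Longrightarrow>
      A (T x) y z + A (T y) z x + A (T z) x y = 0"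
  shows "A x y z = 0"
proof -
  obtain e1 e2 e3 e4 where
    ex: "\<And>x. x = (x \<bullet> c / (c \<bullet> c)) *\<^sub>R c + (x \<bullet> e1) *\<^sub>R e1 + (x \<bullet> e2) *\<^sub>R e2 + (x \<bullet> e3) *\<^sub>R e3 + (x \<bullet> e4) *\<^sub>R e4"
    and ec: "e1 \<bullet> c = 0" "e2 \<bullet> c = 0" "e3 \<bullet> c = 0" "e4 \<bullet> c = 0"
    and ee: "e1 \<bullet> e1 = 1" "e2 \<bullet> e2 = 1" "e3 \<bullet> e3 = 1" "e4 \<bullet> e4 = 1"
    "e1 \<bullet> e2 = 0" "e1 \<bullet> e3 = 0" "e1 \<bullet> e4 = 0" "e2 \<bullet> e3 = 0" "e2 \<bullet> e4 = 0" "e3 \<bullet> e4 = 0"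
    by (rule orthonormal_basis_5[OF dim c(1)]) (rule that)
  have A1: "A w y z = (w \<bullet> e1) * A e1 y z + (w \<bullet> e2) * A e2 y z + (w \<bullet> e3) * A e3 y z
      + (w \<bullet> e4) * A e4 y z" for w y z
    using arg_cong[OF ex[of w], of "\<lambda>w. A w y z"]
    by (simp only: linear_add[OF lin] linear_cmul[OF lin] c(3) real_scaleR_def mult_zero_right add_0)
  have same: "A p p q = 0" "A p q p = 0" "A q p p = 0" for p q
    using alt12[of p p q] alt23[of q p p] alt12[of p q p] by auto
  \<comment> \<open>The signs are chosen so that on the complement of \<open>c\<close> the value
    \<open>A x y z\<close> is the determinant of \<open>a\<close>, \<open>x\<close>,
    \<open>y\<close>, \<open>z\<close> in the basis \<open>e1\<close>, ...,
    \<open>e4\<close>.\<close>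
  define a where "a = A e2 e3 e4 *\<^sub>R e1 - A e1 e3 e4 *\<^sub>R e2 + A e1 e2 e4 *\<^sub>R e3 - A e1 e2 e3 *\<^sub>R e4"
  have Ta: "T a \<bullet> w = A e2 e3 e4 * (T e1 \<bullet> w) - A e1 e3 e4 * (T e2 \<bullet> w)
      + A e1 e2 e4 * (T e3 \<bullet> w) - A e1 e2 e3 * (T e4 \<bullet> w)" for w
    by (simp add: a_def linear_add[OF T(1)] linear_diff[OF T(1)] linear_cmul[OF T(1)]
        inner_add_left inner_diff_left)
  have skew: "T p \<bullet> p = 0" for p using T(2)[of p p] by (simp add: inner_commute)
  have swap: "T p \<bullet> q = - (T q \<bullet> p)" for p q using T(2)[of p q] by (simp add: inner_commute)
  have sort: "A e2 e1 p = - A e1 e2 p" "A e3 e1 p = - A e1 e3 p" "A e4 e1 p = - A e1 e4 p"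
    "A e3 e2 p = - A e2 e3 p" "A e4 e2 p = - A e2 e4 p" "A e4 e3 p = - A e3 e4 p"
    "A p e2 e1 = - A p e1 e2" "A p e3 e1 = - A p e1 e3" "A p e4 e1 = - A p e1 e4"
    "A p e3 e2 = - A p e2 e3" "A p e4 e2 = - A p e2 e4" "A p e4 e3 = - A p e3 e4" for p
    by (rule alt12 alt23)+
  have sT: "T e2 \<bullet> e1 = - (T e1 \<bullet> e2)" "T e3 \<bullet> e1 = - (T e1 \<bullet> e3)" "T e4 \<bullet> e1 = - (T e1 \<bullet> e4)"
    "T e3 \<bullet> e2 = - (T e2 \<bullet> e3)" "T e4 \<bullet> e2 = - (T e2 \<bullet> e4)" "T e4 \<bullet> e3 = - (T e3 \<bullet> e4)"
    by (rule swap)+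
  have "T a \<bullet> c = 0" using T(2)[of a c] c(2) by simp
  \<comment> \<open>Evaluated on the three basis vectors other than \<open>ei\<close>,
    \<open>deriv\<close> is the \<open>ei\<close>-component of \<open>T a\<close> up to
    sign.\<close>
  moreover have "T a \<bullet> e4 = 0" using deriv[OF ec(1,2,3)]
    unfolding A1[of "T _"] Ta by (simp add: sort sT skew same algebra_simps)
  moreover have "T a \<bullet> e3 = 0" using deriv[OF ec(1,2,4)]
    unfolding A1[of "T _"] Ta by (simp add: sort sT skew same algebra_simps)
  moreover have "T a \<bullet> e2 = 0" using deriv[OF ec(1,3,4)]
    unfolding A1[of "T _"] Ta by (simp add: sort sT skew same algebra_simps)
  moreover have "T a \<bullet> e1 = 0" using deriv[OF ec(2,3,4)]
    unfolding A1[of "T _"] Ta by (simp add: sort sT skew same algebra_simps)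
  ultimately have "T a = 0"
    using ex[of "T a"] by (simp only: div_0 scaleR_zero_left add_0)
  moreover have "a \<bullet> c = 0" by (simp add: a_def inner_add_left inner_diff_left ec)
  ultimately have "a = 0" using inj by blast
  then have "a \<bullet> e1 = 0" "a \<bullet> e2 = 0" "a \<bullet> e3 = 0" "a \<bullet> e4 = 0" by simp_all
  then have coeffs: "A e2 e3 e4 = 0" "A e1 e3 e4 = 0" "A e1 e2 e4 = 0" "A e1 e2 e3 = 0"
    by (simp_all add: a_def inner_add_left inner_diff_left ee inner_commute[of e2 e1]
      inner_commute[of e3 e1] inner_commute[of e3 e2] inner_commute[of e4 e1] inner_commute[of e4 e2]
      inner_commute[of e4 e3])
  \<comment> \<open>Linearity is assumed in the first slot only; alternation carries the expansion
    to the other two.\<close>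
  have A2: "A p w z = (w \<bullet> e1) * A p e1 z + (w \<bullet> e2) * A p e2 z + (w \<bullet> e3) * A p e3 z
      + (w \<bullet> e4) * A p e4 z" for p w z
    using A1[of w p z] by (simp add: alt12[of p])
  have A3: "A p q w = (w \<bullet> e1) * A p q e1 + (w \<bullet> e2) * A p q e2 + (w \<bullet> e3) * A p q e3
      + (w \<bullet> e4) * A p q e4" for p q w
    using A2[of p w q] by (simp add: alt23[of p q])
  show ?thesis
    unfolding A1[of x] A2[of _ y] A3[of _ _ z] by (simp add: sort same coeffs)
qed

section \<open>The Levi-Civita connection\<close>

lemma bilinear_nabla:
  assumes "lie_bracket br"
  shows "bilinear (nabla br)"
proof -
  have b: "bilinear br" using assms by (simp add: lie_bracket_def)
  note k = nabla_koszul[OF assms]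
  note s = bilinear_ladd[OF b] bilinear_radd[OF b] bilinear_lmul[OF b] bilinear_rmul[OF b]
    inner_add_left inner_add_right
  have half: "u = v" if "\<And>z. 2 * (u \<bullet> z) = 2 * (v \<bullet> z)" for u v :: 'a
    using that by (metis mult_cancel_left vector_eq_rdot zero_neq_numeral)
  show ?thesis
    unfolding bilinear_def
  proof (intro conjI allI linearI)
    fix x y y' r
    show "nabla br x (y + y') = nabla br x y + nabla br x y'"
      by (rule half) (simp add: k s inner_add_left distrib_left)
    show "nabla br x (r *\<^sub>R y) = r *\<^sub>R nabla br x y"
      by (rule half) (simp add: mult.left_commute[of 2] k s algebra_simps)
    show "nabla br (y + y') x = nabla br y x + nabla br y' x"
      by (rule half) (simp add: k s inner_add_left distrib_left)
    show "nabla br (r *\<^sub>R y) x = r *\<^sub>R nabla br y x"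
      by (rule half) (simp add: mult.left_commute[of 2] k s algebra_simps)
  qed
qed

lemma lie_bracket_anticommute:
  assumes "lie_bracket br"
  shows "br x y = - br y x"
proof -
  have b: "bilinear br" and alt: "\<And>x. br x x = 0" using assms by (simp_all add: lie_bracket_def)
  have "br (x + y) (x + y) = br x x + br x y + (br y x + br y y)"
    by (simp only: bilinear_ladd[OF b] bilinear_radd[OF b] add_ac)
  then show ?thesis using alt by (simp add: eq_neg_iff_add_eq_0)
qed

text \<open>The right-hand side of the Koszul formula changes sign when \<open>y\<close> and
  \<open>z\<close> are exchanged.\<close>

lemma nabla_metric:
  assumes "lie_bracket br"
  shows "nabla br x y \<bullet> z = - (y \<bullet> nabla br x z)"
  using nabla_koszul[OF assms, of x y z] nabla_koszul[OF assms, of x z y]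
    lie_bracket_anticommute[OF assms, of x y] lie_bracket_anticommute[OF assms, of z x]
    lie_bracket_anticommute[OF assms, of y z]
  by (simp add: inner_commute)

lemma nabla_torsion_free:
  assumes "lie_bracket br"
  shows "nabla br x y - nabla br y x = br x y"
proof -
  have "(nabla br x y - nabla br y x) \<bullet> z = br x y \<bullet> z" for z
    using nabla_koszul[OF assms, of x y z] nabla_koszul[OF assms, of y x z]
      lie_bracket_anticommute[OF assms, of y x] lie_bracket_anticommute[OF assms, of z x]
      lie_bracket_anticommute[OF assms, of y z]
    by (simp add: inner_diff_left)
  then show ?thesis by (metis vector_eq_rdot)
qed

lemma nabla_endo_skew:
  assumes "lie_bracket br" and "\<And>x y. T x \<bullet> y = - (x \<bullet> T y)"
  shows "nabla_endo br x T y \<bullet> z = - (nabla_endo br x T z \<bullet> y)"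
  using nabla_metric[OF assms(1), of x "T y" z] nabla_metric[OF assms(1), of x "T z" y]
    assms(2)[of y "nabla br x z"] assms(2)[of z "nabla br x y"]
  by (simp add: nabla_endo_def inner_diff_left inner_commute[of y] inner_commute[of z])

text \<open>A metric torsion-free connection computes the exterior derivative by alternation.
  Applied twice below: to \<open>T\<close>, giving d\<omega>, and to \<open>D\<close>, where the
  Jacobi identity makes the right-hand side vanish.\<close>

lemma nabla_endo_cyclic:
  assumes "lie_bracket br" and "linear T" and "\<And>x y. T x \<bullet> y = - (x \<bullet> T y)"
  shows "nabla_endo br x T y \<bullet> z + nabla_endo br y T z \<bullet> x + nabla_endo br z T x \<bullet> y =
    - (T (br x y) \<bullet> z) - T (br y z) \<bullet> x - T (br z x) \<bullet> y"
proof -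
  have e: "nabla_endo br x T y \<bullet> z = T (nabla br x z) \<bullet> y - T (nabla br x y) \<bullet> z" for x y z
    using nabla_metric[OF assms(1), of x "T y" z] assms(3)[of "nabla br x z" y]
    by (simp add: nabla_endo_def inner_diff_left inner_commute[of _ "T y"])
  show ?thesis
    by (simp add: e nabla_torsion_free[OF assms(1), symmetric] linear_diff[OF assms(2)]
        inner_diff_left)
qed

lemma linear_endo_of:
  assumes "two_form \<omega>"
  shows "linear (endo_of \<omega>)"
proof (rule linearI)
  have b: "bilinear \<omega>" using assms by (simp add: two_form_def)
  fix x y r
  have "endo_of \<omega> (x + y) \<bullet> z = (endo_of \<omega> x + endo_of \<omega> y) \<bullet> z" for z
    by (simp add: endo_of_inner[OF assms] inner_add_left bilinear_ladd[OF b])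
  then show "endo_of \<omega> (x + y) = endo_of \<omega> x + endo_of \<omega> y" by (metis vector_eq_rdot)
  have "endo_of \<omega> (r *\<^sub>R x) \<bullet> z = (r *\<^sub>R endo_of \<omega> x) \<bullet> z" for z
    by (simp add: endo_of_inner[OF assms] bilinear_lmul[OF b])
  then show "endo_of \<omega> (r *\<^sub>R x) = r *\<^sub>R endo_of \<omega> x" by (metis vector_eq_rdot)
qed

lemma endo_of_skew:
  assumes "two_form \<omega>"
  shows "endo_of \<omega> x \<bullet> y = - (x \<bullet> endo_of \<omega> y)"
proof -
  have b: "bilinear \<omega>" and alt: "\<And>x. \<omega> x x = 0" using assms by (simp_all add: two_form_def)
  have "\<omega> (x + y) (x + y) = \<omega> x x + \<omega> x y + (\<omega> y x + \<omega> y y)"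
    by (simp only: bilinear_ladd[OF b] bilinear_radd[OF b] add_ac)
  then show ?thesis using alt by (simp add: endo_of_inner[OF assms] inner_commute[of x])
qed

section \<open>CKY 2-forms with central associated vector\<close>

text \<open>Only one Koszul term avoids a bracket with \<xi>. The resulting 2-form is half the
  exterior derivative of the 1-form dual to \<xi>.\<close>

lemma nabla_central:
  assumes "lie_bracket br" and "\<xi> \<in> lie_center br"
  shows "nabla br x \<xi> \<bullet> z = - (br x z \<bullet> \<xi>) / 2" "nabla br \<xi> x = nabla br x \<xi>"
proof -
  have z: "br \<xi> y = 0" "br y \<xi> = 0" for y
    using assms(2) lie_bracket_anticommute[OF assms(1), of y \<xi>] by (simp_all add: lie_center_def)
  show "nabla br x \<xi> \<bullet> z = - (br x z \<bullet> \<xi>) / 2"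
    using nabla_koszul[OF assms(1), of x \<xi> z] lie_bracket_anticommute[OF assms(1), of z x]
    by (simp add: z)
  show "nabla br \<xi> x = nabla br x \<xi>"
    using nabla_torsion_free[OF assms(1), of \<xi> x] by (simp add: z)
qed

lemma CKY_central_closed:
  fixes br :: "'a::euclidean_space \<Rightarrow> 'a \<Rightarrow> 'a"
  assumes lie: "lie_bracket br" and dim: "DIM('a) = 5" and two: "two_form \<omega>"
    and cky: "CKY_eq br \<omega> (\<lambda>x. \<xi> \<bullet> x)" and xi: "\<xi> \<in> lie_center br" "\<xi> \<noteq> 0"
  shows "closed_form br \<omega>"
proof -
  define T where "T = endo_of \<omega>"
  define D where "D x = nabla br x \<xi>" for x
  define A where "A x y z = nabla_endo br x T y \<bullet> z - (x \<bullet> y) * (\<xi> \<bullet> z) + (x \<bullet> z) * (\<xi> \<bullet> y)" for x y z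
  let ?N = "nabla br"
  let ?k = "\<xi> \<bullet> \<xi>"
  note bN = bilinear_nabla[OF lie]
  note N_simps = bilinear_ladd[OF bN] bilinear_radd[OF bN] bilinear_lmul[OF bN] bilinear_rmul[OF bN]
    bilinear_rsub[OF bN] bilinear_rzero[OF bN]
  have linT: "linear T" unfolding T_def by (rule linear_endo_of[OF two])
  have skT: "T x \<bullet> y = - (x \<bullet> T y)" for x y unfolding T_def by (rule endo_of_skew[OF two])
  note T_simps = linear_add[OF linT] linear_cmul[OF linT] linear_diff[OF linT] linear_0[OF linT]
  have linD: "linear D" unfolding D_def using bN by (simp add: bilinear_def)
  have Dz: "D x \<bullet> z = - (br x z \<bullet> \<xi>) / 2" for x z
    unfolding D_def by (rule nabla_central[OF lie xi(1)])
  have skD: "D x \<bullet> y = - (x \<bullet> D y)" for x y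
    using lie_bracket_anticommute[OF lie, of x y] by (simp add: Dz inner_commute[of x])
  have N\<xi>: "?N \<xi> x = D x" for x
    unfolding D_def by (rule nabla_central[OF lie xi(1)])
  have br\<xi>: "br \<xi> x = 0" "br x \<xi> = 0" for x
    using xi(1) lie_bracket_anticommute[OF lie, of x \<xi>] by (simp_all add: lie_center_def)
  have D\<xi>: "D \<xi> = 0" using Dz[of \<xi>] by (metis br\<xi>(1) div_0 inner_zero_left minus_zero vector_eq_rdot)

  have alt23: "A x y z = - A x z y" for x y z
    using nabla_endo_skew[OF lie skT, of x y z] by (simp add: A_def)
  \<comment> \<open>The CKY equation says exactly that the part of \<open>A\<close> symmetric in its
    first two slots vanishes.\<close>
  have alt12: "A x y z = - A y x z" for x y z
    using cky[unfolded CKY_eq_def, rule_format, of x y z]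
    by (simp add: A_def T_def inner_commute algebra_simps)
  have linA: "linear (\<lambda>x. A x y z)" for y z
    by (rule linearI)
      (simp_all add: A_def nabla_endo_def N_simps T_simps inner_add_left inner_diff_left algebra_simps)
  \<comment> \<open>The metric correction terms in \<open>A\<close> cancel in the cyclic
    sum.\<close>
  have cyc: "A x y z + A y z x + A z x y = ext_deriv br \<omega> x y z" for x y z
    using nabla_endo_cyclic[OF lie linT skT, of x y z]
    by (simp add: A_def ext_deriv_def T_def endo_of_inner[OF two] inner_commute[of y x]
        inner_commute[of z x] inner_commute[of z y])
  have dA: "3 * A x y z = ext_deriv br \<omega> x y z" for x y z
    using cyc[of x y z] alt12[of y z x] alt23[of z y x] alt23[of y z x] alt12[of z x y]
      alt12[of y x z] alt23[of x z y] by simp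

  \<comment> \<open>With \<xi> in the first slot the two correction terms cancel, leaving the
    commutator of \<open>D\<close> and \<open>T\<close>.\<close>
  have A\<xi>: "A \<xi> y z = D (T y) \<bullet> z - T (D y) \<bullet> z" for y z
    by (simp add: A_def nabla_endo_def N\<xi> inner_diff_left)
  have T\<xi>_perp: "T \<xi> \<bullet> \<xi> = 0" using skT[of \<xi> \<xi>] by (simp add: inner_commute)
  have DT\<xi>: "D (T \<xi>) = 0"
  proof -
    have "D (T \<xi>) \<bullet> y = 0" for y
      using A\<xi>[of y \<xi>] alt23[of \<xi> y \<xi>] alt12[of \<xi> \<xi> y] skD[of "T y" \<xi>] skT[of "D y" \<xi>] skD[of y "T \<xi>"]
      by (simp add: D\<xi> inner_commute)
    then show ?thesis by (metis inner_zero_left vector_eq_rdot)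
  qed
  have T\<xi>: "T \<xi> = 0"
  proof -
    let ?u = "T \<xi>"
    have "?N ?u ?u \<bullet> ?u = 0"
      using nabla_metric[OF lie, of ?u ?u ?u] by (simp add: inner_commute)
    \<comment> \<open>\<open>D ?u = 0\<close> removes the term with \<open>T\<close>, and metricity
      removes the other derivative; only a correction term survives.\<close>
    then have "A ?u \<xi> ?u = (?u \<bullet> ?u) * ?k"
      using DT\<xi> by (simp add: A_def nabla_endo_def inner_diff_left T\<xi>_perp T_simps D_def[symmetric])
    moreover have "A ?u \<xi> ?u = 0"
      using alt12[of ?u \<xi> ?u] alt23[of \<xi> ?u ?u] by simp
    ultimately show ?thesis using xi(2) by simp
  qed
  have \<xi>T: "T x \<bullet> \<xi> = 0" for x using skT[of x \<xi>] by (simp add: T\<xi>)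
  \<comment> \<open>In \<open>3 * A\<close> = d\<omega> the brackets with \<xi> vanish, and the
    remaining term pairs an image of \<open>T\<close> with \<xi>.\<close>
  have A\<xi>0: "A \<xi> y z = 0" for y z
    using dA[of \<xi> y z] endo_of_inner[OF two, of "br y z" \<xi>] \<xi>T[of "br y z"] two
    by (simp add: ext_deriv_def br\<xi> T_def two_form_def bilinear_lzero)
  \<comment> \<open>Read off from \<open>A x \<xi> z = 0\<close>: \<open>T\<close> after
    \<open>D\<close> is \<open>?k\<close> times the orthogonal projection off \<xi>.\<close>
  have TD: "T (D x) = ?k *\<^sub>R x - (x \<bullet> \<xi>) *\<^sub>R \<xi>" for x
  proof -
    have "T (D x) \<bullet> z = (?k *\<^sub>R x - (x \<bullet> \<xi>) *\<^sub>R \<xi>) \<bullet> z" for z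
      using alt12[of x \<xi> z] A\<xi>0[of x z]
      by (simp add: A_def nabla_endo_def N_simps T\<xi> D_def[symmetric] inner_diff_left mult.commute)
    then show ?thesis by (metis vector_eq_rdot)
  qed
  have DT: "D (T x) = ?k *\<^sub>R x - (x \<bullet> \<xi>) *\<^sub>R \<xi>" for x
  proof -
    have "D (T x) \<bullet> z = T (D x) \<bullet> z" for z using A\<xi>[of x z] A\<xi>0[of x z] by simp
    then show ?thesis by (metis vector_eq_rdot TD)
  qed

  \<comment> \<open>This differentiates the relation \<open>D (T y) = ?k *\<^sub>R y\<close>, valid
    for \<open>y\<close> orthogonal to \<xi>, to express the derivative of \<open>D\<close> through
    that of \<open>T\<close>.\<close>
  have nD: "nabla_endo br x D (T y) \<bullet> T z = ?k * A x y z" if "y \<bullet> \<xi> = 0" "z \<bullet> \<xi> = 0" for x y z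
  proof -
    have perp: "\<xi> \<bullet> y = 0" "\<xi> \<bullet> z = 0" using that by (simp_all add: inner_commute)
    have "T (nabla_endo br x D (T y)) \<bullet> z = ?k * (T (?N x y) \<bullet> z) - ?k * (?N x (T y) \<bullet> z)"
      using that by (simp add: nabla_endo_def DT TD N_simps T_simps inner_diff_left perp)
    also have "\<dots> = - ?k * A x y z"
      by (simp add: A_def nabla_endo_def inner_diff_left perp algebra_simps)
    finally show ?thesis using skT[of "nabla_endo br x D (T y)" z] by simp
  qed
  have D_closed: "nabla_endo br x D y \<bullet> z + nabla_endo br y D z \<bullet> x + nabla_endo br z D x \<bullet> y = 0"
    for x y z
  proof -
    have "br (br x y) z + br (br y z) x + br (br z x) y
        = - (br x (br y z) + br y (br z x) + br z (br x y))"
      using lie_bracket_anticommute[OF lie, of "br x y" z]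
        lie_bracket_anticommute[OF lie, of "br y z" x]
        lie_bracket_anticommute[OF lie, of "br z x" y] by simp
    also have "\<dots> = 0" using lie by (simp add: lie_bracket_def)
    finally have "(br (br x y) z + br (br y z) x + br (br z x) y) \<bullet> \<xi> = 0" by simp
    then show ?thesis
      by (simp add: nabla_endo_cyclic[OF lie linD skD] Dz inner_add_left)
  qed
  have "A (T x) y z + A (T y) z x + A (T z) x y = 0"
    if "x \<bullet> \<xi> = 0" "y \<bullet> \<xi> = 0" "z \<bullet> \<xi> = 0" for x y z
  proof -
    have "?k * (A (T x) y z + A (T y) z x + A (T z) x y) = 0"
      \<comment> \<open>With all three arguments in the image of \<open>T\<close>, \<open>nD\<close>
        turns each cyclic term into \<open>?k\<close> times a value of \<open>A\<close>.\<close>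
      using D_closed[of "T x" "T y" "T z"] that by (simp add: nD distrib_left)
    then show ?thesis using xi(2) by simp
  qed
  moreover have "x = 0" if "x \<bullet> \<xi> = 0" "T x = 0" for x
    using DT[of x] that linear_0[OF linD] xi(2) by simp
  ultimately have "A x y z = 0" for x y z
    using alternating_3_form_eq_0[of A T \<xi>, OF dim linA alt12 alt23 linT skT xi(2) T\<xi> A\<xi>0] by blast
  then show ?thesis using dA by (simp add: closed_form_def)
qed

theorem proposition6p1:
  fixes br :: "'a::euclidean_space \<Rightarrow> 'a \<Rightarrow> 'a"
    and \<omega> :: "'a \<Rightarrow> 'a \<Rightarrow> real"
  assumes "lie_bracket br"
    and "DIM('a) = 5"
    and "strict_CKY br \<omega>"
    and "cky_vector br \<omega> \<in> lie_center br"
  shows "star_KY br \<omega>"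
proof -
  obtain \<theta> where two: "two_form \<omega>" and \<theta>: "linear \<theta>" "\<theta> \<noteq> (\<lambda>_. 0)" "CKY_eq br \<omega> \<theta>"
    using assms(3) by (auto simp: strict_CKY_def)
  have eq: "\<theta> = (\<lambda>x. cky_vector br \<omega> \<bullet> x)"
    using cky_vector_inner[OF \<theta>(1,3)] assms(2) by auto
  \<comment> \<open>Strictness enters here.\<close>
  then have "cky_vector br \<omega> \<noteq> 0" using \<theta>(2) by auto
  then have "closed_form br \<omega>"
    using CKY_central_closed[OF assms(1,2) two _ assms(4)] \<theta>(3) eq by simp
  then show ?thesis using two \<theta> by (auto simp: star_KY_def CKY_def)
qed

end
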